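(* Let $(c_d)_{d\ge 0}$ be the asymptotic degree distribution of the random graph process (version 1) described in the context, i.e. $c_d=\lim_{n\to\infty}X[n,d]/(n+1)$ almost surely. Then $$c_d=(d+1)\int_0^\infty\frac{y^d e^{-y}}{(1+y)^{d+2}}\,dy\qquad (d\ge 0),$$ and $\sum_{d=0}^\infty c_d=1$.
   Context: Random graph process, version 1: the process starts (after $0$ steps) with the graph consisting of a single vertex and no edges. It evolves in discrete steps; one new vertex is born at each step, so there are $n+1$ vertices after $n$ steps. The graph is always simple. At each step, two (not necessarily different) old vertices $u,v$ (i.e. vertices already present before the step) are chosen independently of each other and of the past, each uniformly at random among all old vertices. Duplication part: the new vertex is added to the graph and connected by an edge to $u$ and to every neighbour of $u$. Deletion part: afterwards, all edges emanating from $v$ are deleted, except that edges incident to the new vertex are not deleted (so if $v$ is connected to the new vertex, that edge is kept). $X[n,d]$ denotes the number of vertices of degree $d$ after $n$ steps. For every $d\ge0$ the proportion $X[n,d]/(n+1)$ converges almost surely, as $n\to\infty$, to a deterministic positive number, denoted $c_d$; these numbers satisfy $c_0=\frac{1+c_1}{3}$ and $c_d=\frac{d+1}{2d+3}(c_{d-1}+c_{d+1})$ for $d\ge 1$. *)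

theory Defs
  imports "HOL-Probability.Probability"
begin

text \<open>
  A simple graph is given by its set of edges, each edge being a two-element set of vertices.
  Vertices are named by their time of birth, so the vertex set after \<open>n\<close> steps is \<open>{..n}\<close>.
\<close>

definition neighbours :: "nat set set \<Rightarrow> nat \<Rightarrow> nat set" where
  "neighbours E u = {w. {u, w} \<in> E}"

definition vertex_degree :: "nat set set \<Rightarrow> nat \<Rightarrow> nat" where
  "vertex_degree E u = card (neighbours E u)"

definition duplicate :: "nat \<Rightarrow> nat \<Rightarrow> nat set set \<Rightarrow> nat set set" where
  "duplicate x u E = E \<union> (\<lambda>w. {x, w}) ` insert u (neighbours E u)"

text \<open>Edges at \<open>v\<close> are deleted, except an edge joining \<open>v\<close> to the newborn vertex \<open>x\<close>.\<close>

definition delete_edges :: "nat \<Rightarrow> nat \<Rightarrow> nat set set \<Rightarrow> nat set set" where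
  "delete_edges x v E = {e \<in> E. v \<in> e \<longrightarrow> x \<in> e}"

text \<open>
  The graph after \<open>n\<close> steps, when \<open>u k\<close> and \<open>v k\<close> are the old vertices chosen for duplication
  and deletion in the step that creates vertex \<open>Suc k\<close>.
\<close>

primrec graph_after :: "(nat \<Rightarrow> nat) \<Rightarrow> (nat \<Rightarrow> nat) \<Rightarrow> nat \<Rightarrow> nat set set" where
  "graph_after u v 0 = {}"
| "graph_after u v (Suc n) =
     delete_edges (Suc n) (v n) (duplicate (Suc n) (u n) (graph_after u v n))"

text \<open>
  Joint independence of all choices expresses that the two choices of each step are independent
  of each other and of the past.  The choices of step \<open>Suc n\<close> lie in \<open>{..n}\<close> almost surely.
\<close>

locale duplication_deletion_process = prob_space M
  for M :: "'a measure" +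
  fixes U V :: "nat \<Rightarrow> 'a \<Rightarrow> nat"
  assumes indep_choices:
      "indep_vars (\<lambda>_. count_space UNIV) (case_sum U V) (UNIV :: (nat + nat) set)"
    and uniform_U: "\<And>n. distr M (count_space UNIV) (U n) = measure_pmf (pmf_of_set {..n})"
    and uniform_V: "\<And>n. distr M (count_space UNIV) (V n) = measure_pmf (pmf_of_set {..n})"

definition degree_count ::
  "(nat \<Rightarrow> 'a \<Rightarrow> nat) \<Rightarrow> (nat \<Rightarrow> 'a \<Rightarrow> nat) \<Rightarrow> nat \<Rightarrow> nat \<Rightarrow> 'a \<Rightarrow> nat" where
  "degree_count U V n d \<omega> =
     card {w \<in> {..n}. vertex_degree (graph_after (\<lambda>k. U k \<omega>) (\<lambda>k. V k \<omega>) n) w = d}"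

end

theory Submission
  imports Defs "HOL-Real_Asymp.Real_Asymp"
begin

text \<open>
  The limit hypothesis already provides deterministic numbers \<open>c d\<close>, so only mean values have to
  be followed through the process. Proportions lie in \<open>[0, 1]\<close>, hence dominated convergence turns
  the almost sure limits into limits of mean proportions. The increments of the mean number of
  vertices of degree \<open>d\<close> are computed exactly: in a fixed graph with \<open>N\<close> vertices, an old vertex
  \<open>w\<close> of degree \<open>k\<close> gains a neighbour for \<open>k + 1\<close> of the \<open>N\<close> choices of \<open>u\<close>; independently of
  this, one choice of \<open>v\<close> wipes out its neighbours and \<open>k\<close> choices take away one neighbour. Hence
  summing a statistic \<open>\<Sum>w. \<phi> (deg w)\<close> over all outcomes of a step gives a statistic of the
  same form for the old graph (\<open>sum_choices_degree_sum\<close>).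

  Only the event \<open>v = w\<close> involves all degrees at once, through the sum of degrees, whose mean is
  exactly \<open>2 * n\<close> after \<open>n\<close> steps (\<open>expectation_total_degree\<close>); so, up to \<open>O(1/n)\<close>,
  that event contributes one isolated vertex per step and nothing else. As \<open>n\<close> grows the
  increments of the mean counts converge, and since the average of convergent increments has the same limit,
  this limit is \<open>c d\<close>. This is the recurrence \<open>limit_recurrence\<close>, which for \<open>d > 0\<close> says
  \<open>(2 * d + 3) * c d = (d + 1) * (c (d - 1) + c (d + 1))\<close>.

  The recurrence has a one-parameter family of solutions, but differences of two solutions grow
  at least linearly unless they vanish (\<open>bounded_homogeneous_zero\<close>), so there is only one bounded
  solution. The integrals give it: with \<open>w d y = y ^ d * exp (- y) / (1 + y) ^ (d + 2)\<close> the
  derivative of \<open>w d\<close> is itself a combination of \<open>w (d - 1)\<close>, \<open>w d\<close> and \<open>w (d + 1)\<close>, and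
  integrating it over the half-line yields the recurrence. With \<open>t = y / (1 + y)\<close> the sum over
  \<open>d\<close> of \<open>(d + 1) * w d y\<close> is \<open>exp (- y) * (1 - t)\<^sup>2\<close> times the derivative series of the geometric
  series, that is \<open>exp (- y)\<close>, so the integrals sum to \<open>1\<close>.
\<close>

section \<open>One step of the process from a fixed graph\<close>

definition simple_graph :: "nat \<Rightarrow> nat set set \<Rightarrow> bool" where
  "simple_graph n E \<longleftrightarrow> (\<forall>e\<in>E. e \<subseteq> {..n} \<and> card e = 2)"

abbreviation evolve :: "nat \<Rightarrow> nat \<Rightarrow> nat \<Rightarrow> nat set set \<Rightarrow> nat set set" where
  "evolve n u v E \<equiv> delete_edges (Suc n) v (duplicate (Suc n) u E)"

lemma mem_neighbours_sym: "w \<in> neighbours E u \<longleftrightarrow> u \<in> neighbours E w"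
  by (simp add: neighbours_def insert_commute)

lemma neighbours_subset:
  assumes "simple_graph n E"
  shows "neighbours E u \<subseteq> {..n} - {u}"
proof
  fix w assume "w \<in> neighbours E u"
  then have "{u, w} \<subseteq> {..n}" "card {u, w} = 2"
    using assms by (auto simp: neighbours_def simple_graph_def)
  then show "w \<in> {..n} - {u}" by (auto simp: card_insert_if split: if_splits)
qed

lemma finite_neighbours: "simple_graph n E \<Longrightarrow> finite (neighbours E u)"
  using neighbours_subset by (metis finite_Diff finite_atMost finite_subset)

lemma vertex_degree_le:
  assumes "simple_graph n E" "w \<le> n"
  shows "vertex_degree E w \<le> n"
  using card_mono[OF _ neighbours_subset[OF assms(1)], of w] assms(2)
  by (simp add: vertex_degree_def)

lemma simple_graph_duplicate:
  assumes "simple_graph n E" "u \<le> n"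
  shows "simple_graph (Suc n) (duplicate (Suc n) u E)"
  using assms neighbours_subset[OF assms(1), of u]
  by (fastforce simp: simple_graph_def duplicate_def)

lemma simple_graph_evolve:
  assumes "simple_graph n E" "u \<le> n"
  shows "simple_graph (Suc n) (evolve n u v E)"
  using simple_graph_duplicate[OF assms] by (simp add: simple_graph_def delete_edges_def)

lemma not_newborn: "simple_graph n E \<Longrightarrow> {w, Suc n} \<notin> E"
  by (force simp: simple_graph_def)

lemma neighbours_duplicate_newborn:
  assumes "simple_graph n E"
  shows "neighbours (duplicate (Suc n) u E) (Suc n) = insert u (neighbours E u)"
  using not_newborn[OF assms]
  by (auto simp: neighbours_def duplicate_def doubleton_eq_iff insert_commute)

lemma neighbours_duplicate_old:
  assumes "simple_graph n E" "w \<le> n"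
  shows "neighbours (duplicate (Suc n) u E) w =
    neighbours E w \<union> (if u \<in> insert w (neighbours E w) then {Suc n} else {})"
  using not_newborn[OF assms(1)] assms(2) mem_neighbours_sym[of w E u]
  by (auto simp: neighbours_def duplicate_def doubleton_eq_iff insert_commute)

lemma neighbours_delete_edges:
  "neighbours (delete_edges x v E) w =
    (if w = x then neighbours E w else if w = v then neighbours E w \<inter> {x} else neighbours E w - ({v} - {x}))"
  by (auto simp: neighbours_def delete_edges_def)

lemma vertex_degree_evolve_newborn:
  assumes "simple_graph n E"
  shows "vertex_degree (evolve n u v E) (Suc n) = Suc (vertex_degree E u)"
  using neighbours_subset[OF assms, of u] finite_neighbours[OF assms, of u]
  by (auto simp: vertex_degree_def neighbours_delete_edges neighbours_duplicate_newborn[OF assms] card_insert_if)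

text \<open>
  The first summand is what deletion leaves of the old neighbours; it depends on \<open>v\<close> only. The
  second counts the edge to the newborn vertex, which deletion spares even for \<open>v = w\<close>; it depends
  on \<open>u\<close> only. This separation makes the two choices act independently on each degree.
\<close>

lemma vertex_degree_evolve_old:
  assumes "simple_graph n E" "w \<le> n" "v \<le> n"
  shows "vertex_degree (evolve n u v E) w =
    (if v = w then 0 else if v \<in> neighbours E w then vertex_degree E w - 1 else vertex_degree E w)
    + of_bool (u \<in> insert w (neighbours E w))"
proof -
  have sub: "neighbours E w \<subseteq> {..n} - {w}" by (rule neighbours_subset[OF assms(1)])
  have fin: "finite (neighbours E w)" by (rule finite_neighbours[OF assms(1)])
  have "Suc n \<notin> neighbours E w" using sub by auto
  then have "neighbours (evolve n u v E) w =
     (if v = w then {} else neighbours E w - {v}) \<union> (if u \<in> insert w (neighbours E w) then {Suc n} else {})"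
    unfolding neighbours_delete_edges neighbours_duplicate_old[OF assms(1,2)]
    using assms(2,3) by auto
  then show ?thesis
    using fin \<open>Suc n \<notin> neighbours E w\<close> by (simp add: vertex_degree_def)
qed

text \<open>
  Two choices of \<open>\<phi>\<close> matter: the indicator of \<open>d\<close> counts the vertices of degree \<open>d\<close>, and the
  identity gives twice the number of edges.
\<close>

definition degree_sum :: "(nat \<Rightarrow> real) \<Rightarrow> nat \<Rightarrow> nat set set \<Rightarrow> real" where
  "degree_sum \<phi> n E = (\<Sum>w\<le>n. \<phi> (vertex_degree E w))"

text \<open>
  The total of \<open>\<phi>\<close> over the \<open>n + 1\<close> choices of \<open>u\<close>, for an old vertex of degree \<open>k\<close> of which
  deletion leaves \<open>a\<close> neighbours: it gains a neighbour when \<open>u\<close> is one of the \<open>k + 1\<close> elements of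
  its closed neighbourhood.
\<close>

definition gain_total :: "(nat \<Rightarrow> real) \<Rightarrow> nat \<Rightarrow> nat \<Rightarrow> nat \<Rightarrow> real" where
  "gain_total \<phi> n k a = (real k + 1) * \<phi> (a + 1) + (real n - real k) * \<phi> a"

text \<open>
  What a vertex of degree \<open>k\<close> contributes to \<open>\<phi>\<close>-sums over all \<open>(n + 1)\<^sup>2\<close> outcomes of a step.
  The first term is its contribution as the duplicated vertex \<open>u\<close>: the newborn then gets degree
  \<open>k + 1\<close>, whatever \<open>v\<close> is. The others are its own later degrees, according to whether \<open>v\<close> is the
  vertex itself, one of its \<open>k\<close> neighbours, or one of the remaining \<open>n - k\<close> vertices. For \<open>k = 0\<close>
  the truncated \<open>k - 1\<close> is harmless because of the factor \<open>k\<close>.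
\<close>

definition step_total :: "(nat \<Rightarrow> real) \<Rightarrow> nat \<Rightarrow> nat \<Rightarrow> real" where
  "step_total \<phi> n k = (real n + 1) * \<phi> (k + 1) + gain_total \<phi> n k 0 + real k * gain_total \<phi> n k (k - 1)
     + (real n - real k) * gain_total \<phi> n k k"

lemma sum_choices_old:
  assumes "simple_graph n E" "w \<le> n"
  defines "k \<equiv> vertex_degree E w"
  shows "(\<Sum>u\<le>n. \<Sum>v\<le>n. \<phi> (vertex_degree (evolve n u v E) w)) =
    gain_total \<phi> n k 0 + real k * gain_total \<phi> n k (k - 1) + (real n - real k) * gain_total \<phi> n k k"
proof -
  let ?N = "neighbours E w"
  have sub: "?N \<subseteq> {..n} - {w}" by (rule neighbours_subset[OF assms(1)])
  have fin: "finite ?N" by (rule finite_neighbours[OF assms(1)])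
  have kn: "k \<le> n" unfolding k_def by (rule vertex_degree_le[OF assms(1,2)])
  have card: "card ?N = k" by (simp add: k_def vertex_degree_def)
  have card': "card (insert w ?N) = k + 1" using sub fin card by (subst card_insert_disjoint) auto
  let ?a = "\<lambda>v. if v = w then 0 else if v \<in> ?N then k - 1 else k"
  \<comment> \<open>the closed neighbourhood of \<open>w\<close> decides the effect of both choices\<close>
  have split: "sum f {..n} = sum f (insert w ?N) + sum f ({..n} - insert w ?N)" for f :: "nat \<Rightarrow> real"
    using sub assms(2) by (subst sum.subset_diff[of "insert w ?N"]) auto
  have rest: "card ({..n} - insert w ?N) = n - k"
    using sub assms(2) card' fin by (subst card_Diff_subset) auto
  have inner: "(\<Sum>u\<le>n. \<phi> (a + of_bool (u \<in> insert w ?N))) = gain_total \<phi> n k a" for a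
  proof -
    have "(\<Sum>u\<in>insert w ?N. \<phi> (a + of_bool (u \<in> insert w ?N))) = (\<Sum>u\<in>insert w ?N. \<phi> (a + 1))"
      by (intro sum.cong) auto
    moreover have "(\<Sum>u\<in>{..n} - insert w ?N. \<phi> (a + of_bool (u \<in> insert w ?N))) =
        (\<Sum>u\<in>{..n} - insert w ?N. \<phi> a)"
      by (intro sum.cong) auto
    ultimately show ?thesis
      unfolding split using kn
      by (simp only: sum_constant card' rest gain_total_def) (simp add: of_nat_diff)
  qed
  have outer: "(\<Sum>v\<le>n. g (?a v)) = g 0 + real k * g (k - 1) + (real n - real k) * g k"
    for g :: "nat \<Rightarrow> real"
  proof -
    have "(\<Sum>v\<in>insert w ?N. g (?a v)) = g 0 + (\<Sum>v\<in>?N. g (k - 1))"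
      using sub fin by (subst sum.insert) (auto simp del: sum_constant intro!: sum.cong)
    moreover have "(\<Sum>v\<in>{..n} - insert w ?N. g (?a v)) = (\<Sum>v\<in>{..n} - insert w ?N. g k)"
      by (intro sum.cong) auto
    ultimately show ?thesis
      unfolding split using kn
      by (simp only: sum_constant card rest) (simp add: of_nat_diff)
  qed
  have "(\<Sum>u\<le>n. \<Sum>v\<le>n. \<phi> (vertex_degree (evolve n u v E) w)) =
      (\<Sum>v\<le>n. \<Sum>u\<le>n. \<phi> (?a v + of_bool (u \<in> insert w ?N)))"
    by (subst sum.swap) (intro sum.cong refl, simp add: vertex_degree_evolve_old[OF assms(1,2)] k_def)
  also have "\<dots> = (\<Sum>v\<le>n. gain_total \<phi> n k (?a v))"
    by (intro sum.cong refl inner)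
  also have "\<dots> = gain_total \<phi> n k 0 + real k * gain_total \<phi> n k (k - 1)
      + (real n - real k) * gain_total \<phi> n k k"
    by (rule outer)
  finally show ?thesis .
qed

text \<open>
  Sums of a function of the degree are closed under averaging over one step, which is what lets
  the mean counts satisfy recurrences of their own.
\<close>

lemma sum_choices_degree_sum:
  assumes "simple_graph n E"
  shows "(\<Sum>u\<le>n. \<Sum>v\<le>n. degree_sum \<phi> (Suc n) (evolve n u v E)) = degree_sum (step_total \<phi> n) n E"
proof -
  have "(\<Sum>u\<le>n. \<Sum>v\<le>n. degree_sum \<phi> (Suc n) (evolve n u v E)) =
     (\<Sum>u\<le>n. \<Sum>v\<le>n. \<phi> (Suc (vertex_degree E u))) +
     (\<Sum>u\<le>n. \<Sum>v\<le>n. \<Sum>w\<le>n. \<phi> (vertex_degree (evolve n u v E) w))"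
    by (simp add: degree_sum_def sum.distrib vertex_degree_evolve_newborn[OF assms])
  also have "(\<Sum>u\<le>n. \<Sum>v\<le>n. \<Sum>w\<le>n. \<phi> (vertex_degree (evolve n u v E) w)) =
     (\<Sum>w\<le>n. \<Sum>u\<le>n. \<Sum>v\<le>n. \<phi> (vertex_degree (evolve n u v E) w))"
    by (subst sum.swap[of _ "{..n}" "{..n}"], subst (2) sum.swap) (rule refl)
  also have "(\<Sum>u\<le>n. \<Sum>v\<le>n. \<phi> (Suc (vertex_degree E u))) =
     (\<Sum>w\<le>n. (real n + 1) * \<phi> (vertex_degree E w + 1))"
    by (simp add: add.commute)
  finally show ?thesis
    unfolding degree_sum_def step_total_def
    by (simp add: sum_choices_old[OF assms] sum.distrib[symmetric] add.assoc)
qed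

text \<open>
  Summed over the \<open>n + 1\<close> vertices and divided by \<open>(n + 1)\<^sup>2\<close>, this says that the mean sum of
  degrees grows by \<open>2\<close>: duplication of \<open>u\<close> adds \<open>deg u + 1\<close> edges, deletion at \<open>v\<close> removes
  \<open>deg v\<close>, and \<open>u\<close>, \<open>v\<close> have the same distribution.
\<close>

lemma step_total_id:
  assumes "k \<le> n"
  shows "step_total real n k = (real n + 1) * ((real n + 1) * real k + 2)"
  by (cases k) (simp_all add: step_total_def gain_total_def algebra_simps)

lemma step_total_indicator:
  "step_total (\<lambda>j. of_bool (j = d)) n k =
     of_bool (Suc k = d) * ((real n + 1) + (real n + 1 - real d) * real d)
   + of_bool (k = d) * (real d * (real d + 1) + (real n - real d)\<^sup>2)
   + of_bool (k = Suc d) * ((real d + 1) * (real n - real d - 1))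
   + of_bool (d = 1) * (real k + 1) + of_bool (d = 0) * (real n - real k)"
  by (cases k) (auto simp: step_total_def gain_total_def algebra_simps power2_eq_square)

lemma graph_after_cong:
  assumes "\<And>k. k < n \<Longrightarrow> u k = u' k" "\<And>k. k < n \<Longrightarrow> v k = v' k"
  shows "graph_after u v n = graph_after u' v' n"
  using assms by (induction n) simp_all

lemma simple_graph_graph_after:
  assumes "\<And>k. u k \<le> k"
  shows "simple_graph n (graph_after u v n)"
proof (induction n)
  case 0
  then show ?case by (simp add: simple_graph_def)
next
  case (Suc n)
  then show ?case using assms by (simp add: simple_graph_evolve)
qed

lemma finite_simple_graphs: "finite {E. simple_graph n E}"
  by (rule finite_subset[of _ "Pow (Pow {..n})"]) (auto simp: simple_graph_def)

text \<open>
  In the indicator case the only terms that do not reduce to counts of degrees near \<open>d\<close> come from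
  \<open>v = w\<close>, after which \<open>w\<close> has degree \<open>0\<close> or \<open>1\<close>; they see the graph through its sum of degrees.
\<close>

lemma degree_sum_step_total_indicator:
  assumes "simple_graph n E"
  defines "X \<equiv> \<lambda>d. degree_sum (\<lambda>k. of_bool (k = d)) n E"
  shows "degree_sum (step_total (\<lambda>k. of_bool (k = d)) n) n E =
     (if d = 0 then 0 else X (d - 1)) * ((real n + 1) + (real n + 1 - real d) * real d)
   + X d * (real d * (real d + 1) + (real n - real d)\<^sup>2)
   + X (Suc d) * ((real d + 1) * (real n - real d - 1))
   + of_bool (d = 1) * (degree_sum real n E + (real n + 1))
   + of_bool (d = 0) * ((real n + 1) * real n - degree_sum real n E)"
proof -
  have "(\<Sum>w\<le>n. of_bool (Suc (vertex_degree E w) = d)) = (if d = 0 then 0 else X (d - 1))"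
    by (cases d) (simp_all add: X_def degree_sum_def)
  then show ?thesis
    by (simp add: degree_sum_def step_total_indicator sum.distrib sum_subtractf X_def
        flip: sum_distrib_left sum_distrib_right)
qed

section \<open>Expectations along the process\<close>

context duplication_deletion_process
begin

abbreviation graph :: "nat \<Rightarrow> 'a \<Rightarrow> nat set set" where
  "graph n \<omega> \<equiv> graph_after (\<lambda>k. U k \<omega>) (\<lambda>k. V k \<omega>) n"

lemma measurable_choice: "case_sum U V s \<in> M \<rightarrow>\<^sub>M count_space UNIV"
  using indep_choices by (simp add: indep_vars_def)

lemma measurable_choices_vector:
  "(\<lambda>\<omega>. restrict (\<lambda>s. case_sum U V s \<omega>) A) \<in> M \<rightarrow>\<^sub>M PiM A (\<lambda>_. count_space UNIV)"
  by (intro measurable_restrict measurable_choice)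

text \<open>
  Finite vectors of naturals form a countable discrete space, so every function on them is
  measurable; this is why the history of choices is kept as such a vector.
\<close>

lemma borel_measurable_discrete_vector:
  fixes f :: "('i \<Rightarrow> nat) \<Rightarrow> real"
  assumes "finite A"
  shows "f \<in> borel_measurable (PiM A (\<lambda>_. count_space UNIV))"
  by (simp add: count_space_PiM_finite[OF assms, of "\<lambda>_. UNIV"])

text \<open>
  The only way in which independence is applied: functions of disjoint finite blocks of choices
  have multiplicative expectations. It serves both to separate a step from the history and to
  separate the two choices within a step.
\<close>

lemma expectation_mult_choices:
  fixes f g :: "((nat + nat) \<Rightarrow> nat) \<Rightarrow> real"
  assumes "finite A" "finite B" "A \<inter> B = {}"
    and "integrable M (\<lambda>\<omega>. f (restrict (\<lambda>s. case_sum U V s \<omega>) A))"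
    and "integrable M (\<lambda>\<omega>. g (restrict (\<lambda>s. case_sum U V s \<omega>) B))"
  shows "expectation (\<lambda>\<omega>. f (restrict (\<lambda>s. case_sum U V s \<omega>) A) * g (restrict (\<lambda>s. case_sum U V s \<omega>) B)) =
    expectation (\<lambda>\<omega>. f (restrict (\<lambda>s. case_sum U V s \<omega>) A)) *
    expectation (\<lambda>\<omega>. g (restrict (\<lambda>s. case_sum U V s \<omega>) B))"
proof (rule indep_var_lebesgue_integral)
  have "indep_var (PiM A (\<lambda>_. count_space UNIV)) (\<lambda>\<omega>. restrict (\<lambda>s. case_sum U V s \<omega>) A)
      (PiM B (\<lambda>_. count_space UNIV)) (\<lambda>\<omega>. restrict (\<lambda>s. case_sum U V s \<omega>) B)"
    using indep_choices by (rule indep_var_restrict) (use assms in auto)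
  from indep_var_compose[OF this borel_measurable_discrete_vector[OF assms(1), of f]
      borel_measurable_discrete_vector[OF assms(2), of g]]
  show "indep_var borel (\<lambda>\<omega>. f (restrict (\<lambda>s. case_sum U V s \<omega>) A))
      borel (\<lambda>\<omega>. g (restrict (\<lambda>s. case_sum U V s \<omega>) B))"
    by (simp add: comp_def)
qed fact+

lemma distr_choice:
  "distr M (count_space UNIV) (case_sum U V s) = measure_pmf (pmf_of_set {..case_sum id id s})"
  by (cases s) (simp_all add: uniform_U uniform_V)

lemma expectation_choice:
  assumes "i \<le> case_sum id id s"
  shows "expectation (\<lambda>\<omega>. of_bool (case_sum U V s \<omega> = i) :: real) = 1 / (real (case_sum id id s) + 1)"
proof -
  let ?D = "measure_pmf (pmf_of_set {..case_sum id id s})"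
  have "expectation (\<lambda>\<omega>. of_bool (case_sum U V s \<omega> = i) :: real) = (\<integral>x. of_bool (x = i) \<partial>?D)"
    unfolding distr_choice[symmetric] by (subst integral_distr[OF measurable_choice]) auto
  also have "\<dots> = (\<integral>x. indicator {i} x \<partial>?D)"
    by (intro Bochner_Integration.integral_cong) (auto split: split_indicator)
  also have "\<dots> = pmf (pmf_of_set {..case_sum id id s}) i"
    by (simp add: measure_pmf_single)
  finally show ?thesis using assms by (simp add: add.commute)
qed

lemma AE_choices_old: "AE \<omega> in M. \<forall>k. U k \<omega> \<le> k \<and> V k \<omega> \<le> k"
proof -
  have *: "AE \<omega> in M. case_sum U V s \<omega> \<le> case_sum id id s" for s
  proof -
    have "AE x in distr M (count_space UNIV) (case_sum U V s). x \<le> case_sum id id s"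
      unfolding distr_choice by (simp add: AE_measure_pmf_iff)
    then show ?thesis by (subst (asm) AE_distr_iff[OF measurable_choice]) auto
  qed
  have "AE \<omega> in M. U k \<omega> \<le> k" "AE \<omega> in M. V k \<omega> \<le> k" for k
    using *[of "Inl k"] *[of "Inr k"] by simp_all
  then show ?thesis by (simp add: AE_all_countable)
qed

lemma AE_simple_graph: "AE \<omega> in M. \<forall>n. simple_graph n (graph n \<omega>)"
  using AE_choices_old by eventually_elim (simp add: simple_graph_graph_after)

lemma graph_of_restricted_choices:
  fixes \<omega> :: 'a and n :: nat
  defines "x \<equiv> restrict (\<lambda>s. case_sum U V s \<omega>) (Inl ` {..<n} \<union> Inr ` {..<n})"
  shows "graph n \<omega> = graph_after (\<lambda>k. x (Inl k)) (\<lambda>k. x (Inr k)) n"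
  unfolding x_def by (intro graph_after_cong) auto

lemma borel_measurable_graph:
  fixes h :: "nat set set \<Rightarrow> real"
  shows "(\<lambda>\<omega>. h (graph n \<omega>)) \<in> borel_measurable M"
  unfolding graph_of_restricted_choices
  by (rule measurable_compose[OF measurable_choices_vector borel_measurable_discrete_vector]) simp

text \<open>
  Almost surely all choices are old vertices, and then the graph is one of finitely many.
\<close>

lemma integrable_graph:
  fixes h :: "nat set set \<Rightarrow> real"
  shows "integrable M (\<lambda>\<omega>. h (graph n \<omega>))"
proof (rule integrable_const_bound)
  show "AE \<omega> in M. norm (h (graph n \<omega>)) \<le> Max ((\<lambda>E. norm (h E)) ` {E. simple_graph n E})"
    using AE_simple_graph by eventually_elim (auto intro!: Max_ge finite_imageI finite_simple_graphs)
qed (rule borel_measurable_graph)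

lemma expectation_graph_choices:
  fixes h :: "nat set set \<Rightarrow> real"
  assumes "i \<le> n" "j \<le> n"
  shows "integrable M (\<lambda>\<omega>. h (graph n \<omega>) * of_bool (U n \<omega> = i \<and> V n \<omega> = j))"
    and "expectation (\<lambda>\<omega>. h (graph n \<omega>) * of_bool (U n \<omega> = i \<and> V n \<omega> = j)) =
      expectation (\<lambda>\<omega>. h (graph n \<omega>)) / (real n + 1)\<^sup>2"
proof -
  let ?A = "Inl ` {..<n} \<union> Inr ` {..<n} :: (nat + nat) set"
  have int: "integrable M (\<lambda>\<omega>. g (restrict (\<lambda>s. case_sum U V s \<omega>) B))"
    if "finite B" "\<And>x. \<bar>g x\<bar> \<le> 1" for g :: "(nat + nat \<Rightarrow> nat) \<Rightarrow> real" and B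
    using that by (intro integrable_const_bound[of _ 1]
        measurable_compose[OF measurable_choices_vector borel_measurable_discrete_vector]) auto
  have "expectation (\<lambda>\<omega>. of_bool (U n \<omega> = i \<and> V n \<omega> = j) :: real) =
      expectation (\<lambda>\<omega>. of_bool (U n \<omega> = i)) * expectation (\<lambda>\<omega>. of_bool (V n \<omega> = j))"
    using expectation_mult_choices[of "{Inl n}" "{Inr n}" "\<lambda>x. of_bool (x (Inl n) = i)" "\<lambda>x. of_bool (x (Inr n) = j)"]
      int[of "{Inl n}" "\<lambda>x. of_bool (x (Inl n) = i)"] int[of "{Inr n}" "\<lambda>x. of_bool (x (Inr n) = j)"]
    by (simp add: of_bool_conj)
  also have "\<dots> = 1 / (real n + 1)\<^sup>2"
    using expectation_choice[of i "Inl n"] expectation_choice[of j "Inr n"] assms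
    by (simp add: power2_eq_square)
  finally have pair: "expectation (\<lambda>\<omega>. of_bool (U n \<omega> = i \<and> V n \<omega> = j) :: real) = 1 / (real n + 1)\<^sup>2" .
  have mult: "expectation (\<lambda>\<omega>. h (graph n \<omega>) * of_bool (U n \<omega> = i \<and> V n \<omega> = j)) =
      expectation (\<lambda>\<omega>. h (graph n \<omega>)) * expectation (\<lambda>\<omega>. of_bool (U n \<omega> = i \<and> V n \<omega> = j))"
    using expectation_mult_choices[of ?A "{Inl n, Inr n}"
        "\<lambda>x. h (graph_after (\<lambda>k. x (Inl k)) (\<lambda>k. x (Inr k)) n)" "\<lambda>x. of_bool (x (Inl n) = i \<and> x (Inr n) = j)"]
      int[of "{Inl n, Inr n}" "\<lambda>x. of_bool (x (Inl n) = i \<and> x (Inr n) = j)"] integrable_graph[of h n]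
    unfolding graph_of_restricted_choices[symmetric] by auto
  then show "expectation (\<lambda>\<omega>. h (graph n \<omega>) * of_bool (U n \<omega> = i \<and> V n \<omega> = j)) =
      expectation (\<lambda>\<omega>. h (graph n \<omega>)) / (real n + 1)\<^sup>2"
    by (simp add: pair)
  have "(\<lambda>\<omega>. of_bool (U n \<omega> = i \<and> V n \<omega> = j) :: real) \<in> borel_measurable M"
    using borel_measurable_integrable[OF int[of "{Inl n, Inr n}" "\<lambda>x. of_bool (x (Inl n) = i \<and> x (Inr n) = j)"]]
    by simp
  then show "integrable M (\<lambda>\<omega>. h (graph n \<omega>) * of_bool (U n \<omega> = i \<and> V n \<omega> = j))"
    by (intro Bochner_Integration.integrable_bound[OF integrable_graph[of h n]] borel_measurable_times
        borel_measurable_graph) auto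
qed

text \<open>
  Conditioning on the history: the choices of the next step are uniform on the pairs of old
  vertices, whatever the present graph.
\<close>

lemma expectation_step:
  fixes h :: "nat set set \<Rightarrow> real"
  shows "expectation (\<lambda>\<omega>. h (graph (Suc n) \<omega>)) =
    expectation (\<lambda>\<omega>. \<Sum>i\<le>n. \<Sum>j\<le>n. h (evolve n i j (graph n \<omega>))) / (real n + 1)\<^sup>2"
proof -
  let ?f = "\<lambda>i j \<omega>. h (evolve n i j (graph n \<omega>)) * of_bool (U n \<omega> = i \<and> V n \<omega> = j)"
  have int: "integrable M (?f i j)" if "i \<le> n" "j \<le> n" for i j
    using that by (rule expectation_graph_choices(1))
  have "AE \<omega> in M. h (graph (Suc n) \<omega>) = (\<Sum>i\<le>n. \<Sum>j\<le>n. ?f i j \<omega>)"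
    using AE_choices_old
  proof eventually_elim
    case (elim \<omega>)
    have "(\<Sum>i\<le>n. \<Sum>j\<le>n. ?f i j \<omega>) = (\<Sum>i\<le>n. \<Sum>j\<le>n. if i = U n \<omega> then
        (if j = V n \<omega> then h (evolve n i j (graph n \<omega>)) else 0) else 0)"
      by (intro sum.cong) auto
    also have "\<dots> = (\<Sum>i\<le>n. if i = U n \<omega> then (\<Sum>j\<le>n. if j = V n \<omega> then h (evolve n i j (graph n \<omega>)) else 0) else 0)"
      by (intro sum.cong) auto
    also have "\<dots> = h (evolve n (U n \<omega>) (V n \<omega>) (graph n \<omega>))"
      using elim by simp
    finally show ?case by simp
  qed
  then have "expectation (\<lambda>\<omega>. h (graph (Suc n) \<omega>)) = expectation (\<lambda>\<omega>. \<Sum>i\<le>n. \<Sum>j\<le>n. ?f i j \<omega>)"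
    by (intro integral_cong_AE borel_measurable_graph borel_measurable_sum borel_measurable_integrable int) auto
  also have "\<dots> = (\<Sum>i\<le>n. expectation (\<lambda>\<omega>. \<Sum>j\<le>n. ?f i j \<omega>))"
    by (intro Bochner_Integration.integral_sum Bochner_Integration.integrable_sum int) auto
  also have "\<dots> = (\<Sum>i\<le>n. \<Sum>j\<le>n. expectation (?f i j))"
    by (intro sum.cong refl Bochner_Integration.integral_sum int) auto
  also have "\<dots> = (\<Sum>i\<le>n. \<Sum>j\<le>n. expectation (\<lambda>\<omega>. h (evolve n i j (graph n \<omega>))) / (real n + 1)\<^sup>2)"
    by (intro sum.cong refl expectation_graph_choices(2)) auto
  also have "\<dots> = (\<Sum>i\<le>n. \<Sum>j\<le>n. expectation (\<lambda>\<omega>. h (evolve n i j (graph n \<omega>)))) / (real n + 1)\<^sup>2"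
    by (simp add: sum_divide_distrib)
  also have "(\<Sum>i\<le>n. \<Sum>j\<le>n. expectation (\<lambda>\<omega>. h (evolve n i j (graph n \<omega>)))) =
      expectation (\<lambda>\<omega>. \<Sum>i\<le>n. \<Sum>j\<le>n. h (evolve n i j (graph n \<omega>)))"
    by (simp add: Bochner_Integration.integral_sum integrable_graph[where h = "\<lambda>E. h (evolve n _ _ E)"]
        Bochner_Integration.integrable_sum)
  finally show ?thesis .
qed

lemma expectation_degree_sum_step:
  "expectation (\<lambda>\<omega>. degree_sum \<phi> (Suc n) (graph (Suc n) \<omega>)) =
   expectation (\<lambda>\<omega>. degree_sum (step_total \<phi> n) n (graph n \<omega>)) / (real n + 1)\<^sup>2"
proof -
  have "expectation (\<lambda>\<omega>. \<Sum>i\<le>n. \<Sum>j\<le>n. degree_sum \<phi> (Suc n) (evolve n i j (graph n \<omega>))) =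
      expectation (\<lambda>\<omega>. degree_sum (step_total \<phi> n) n (graph n \<omega>))"
  proof (rule integral_cong_AE)
    show "AE \<omega> in M. (\<Sum>i\<le>n. \<Sum>j\<le>n. degree_sum \<phi> (Suc n) (evolve n i j (graph n \<omega>))) =
        degree_sum (step_total \<phi> n) n (graph n \<omega>)"
      using AE_simple_graph by eventually_elim (simp add: sum_choices_degree_sum)
  qed (rule borel_measurable_graph[where h = "\<lambda>E. \<Sum>i\<le>n. \<Sum>j\<le>n. degree_sum \<phi> (Suc n) (evolve n i j E)"]
      borel_measurable_graph)+
  then show ?thesis by (simp only: expectation_step)
qed

text \<open>
  This controls the term in the increments of the mean counts that involves all degrees at once:
  divided by \<open>(n + 1)\<^sup>2\<close> it tends to \<open>0\<close>.
\<close>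

lemma expectation_total_degree: "expectation (\<lambda>\<omega>. degree_sum real n (graph n \<omega>)) = 2 * real n"
proof (induction n)
  case 0
  have "degree_sum real 0 (graph 0 \<omega>) = 0" for \<omega>
    by (simp add: degree_sum_def vertex_degree_def neighbours_def)
  then show ?case by simp
next
  case (Suc n)
  have "expectation (\<lambda>\<omega>. degree_sum (step_total real n) n (graph n \<omega>)) =
      expectation (\<lambda>\<omega>. (real n + 1)\<^sup>2 * (degree_sum real n (graph n \<omega>) + 2))"
  proof (rule integral_cong_AE)
    show "AE \<omega> in M. degree_sum (step_total real n) n (graph n \<omega>) =
       (real n + 1)\<^sup>2 * (degree_sum real n (graph n \<omega>) + 2)"
      using AE_simple_graph
    proof eventually_elim
      case (elim \<omega>)
      have "degree_sum (step_total real n) n (graph n \<omega>) =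
         (\<Sum>w\<le>n. (real n + 1) * ((real n + 1) * real (vertex_degree (graph n \<omega>) w) + 2))"
        unfolding degree_sum_def
        by (intro sum.cong refl step_total_id vertex_degree_le) (use elim in auto)
      also have "\<dots> = (real n + 1) * ((real n + 1) * degree_sum real n (graph n \<omega>) + (real n + 1) * 2)"
        by (simp add: degree_sum_def sum.distrib sum_distrib_left[symmetric])
      finally show ?case by (simp add: power2_eq_square algebra_simps)
    qed
  qed (rule borel_measurable_graph borel_measurable_graph[where h = "\<lambda>E. (real n + 1)\<^sup>2 * (degree_sum real n E + 2)"])+
  also have "\<dots> = (real n + 1)\<^sup>2 * (2 * real n + 2)"
    using integrable_graph[of "degree_sum real n" n] by (simp add: Suc prob_space)
  finally have total: "expectation (\<lambda>\<omega>. degree_sum (step_total real n) n (graph n \<omega>)) =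
      (real n + 1)\<^sup>2 * (2 * real n + 2)" .
  have "real n + 1 \<noteq> 0" by linarith
  then show ?case
    unfolding expectation_degree_sum_step total by simp
qed

end

section \<open>The integrals and the recurrence\<close>

definition degree_weight :: "nat \<Rightarrow> real \<Rightarrow> real" where
  "degree_weight d y = y ^ d * exp (- y) / (1 + y) ^ (d + 2)"

definition degree_density :: "nat \<Rightarrow> real" where
  "degree_density d = (real d + 1) * (LBINT y:{0..}. degree_weight d y)"

lemma degree_weight_nonneg: "0 \<le> y \<Longrightarrow> 0 \<le> degree_weight d y"
  by (simp add: degree_weight_def)

lemma degree_weight_le_exp:
  assumes "0 \<le> y"
  shows "degree_weight d y \<le> exp (- y)"
proof -
  have "y ^ d \<le> (1 + y) ^ d" using assms by (intro power_mono) auto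
  also have "\<dots> \<le> (1 + y) ^ (d + 2)" using assms by (intro power_increasing) auto
  finally have "y ^ d / (1 + y) ^ (d + 2) \<le> 1" using assms by (simp add: divide_le_eq_1)
  then have "y ^ d / (1 + y) ^ (d + 2) * exp (- y) \<le> 1 * exp (- y)"
    by (intro mult_right_mono) auto
  then show ?thesis by (simp add: degree_weight_def)
qed

lemma continuous_on_degree_weight: "continuous_on {0..} (degree_weight d)"
  unfolding degree_weight_def by (intro continuous_intros) auto

lemma has_bochner_integral_exp_minus:
  "has_bochner_integral lborel (\<lambda>y. indicator {0..} y *\<^sub>R exp (- y) :: real) 1"
proof (rule has_bochner_integral_nn_integral)
  have "(\<integral>\<^sup>+ y. ennreal (indicator {0..} y *\<^sub>R exp (- y) :: real) \<partial>lborel) =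
        (\<integral>\<^sup>+ y. ennreal (y ^ 0 * exp (- y)) * indicator {0..} y \<partial>lborel)"
    by (intro nn_integral_cong) (auto split: split_indicator)
  then show "(\<integral>\<^sup>+ y. ennreal (indicator {0..} y *\<^sub>R exp (- y) :: real) \<partial>lborel) = ennreal 1"
    unfolding nn_intergal_power_times_exp_Ici by simp
qed (auto split: split_indicator)

lemma set_integrable_degree_weight: "set_integrable lborel {0..} (degree_weight d)"
proof -
  have exp: "integrable lborel (\<lambda>y. indicator {0..} y *\<^sub>R exp (- y) :: real)"
    using has_bochner_integral_exp_minus by (rule integrable.intros)
  have "(\<lambda>y. indicator {0..} y *\<^sub>R degree_weight d y) \<in> borel_measurable borel"
    unfolding degree_weight_def by measurable
  then show ?thesis
    unfolding set_integrable_def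
    by (intro Bochner_Integration.integrable_bound[OF exp])
       (auto split: split_indicator simp: degree_weight_le_exp degree_weight_nonneg)
qed

text \<open>
  With \<open>t = y / (1 + y)\<close> the weight is \<open>exp (- y) * t ^ d * (1 - t)\<^sup>2\<close>, and \<open>t\<close> has derivative
  \<open>(1 - t)\<^sup>2\<close>. So the derivative is \<open>exp (- y) * t ^ (d - 1) * (1 - t)\<^sup>2\<close> times a quadratic
  polynomial in \<open>t\<close>, whose three coefficients are those on the right. For \<open>d = 0\<close> the truncated
  index \<open>d - 1\<close> carries the factor \<open>0\<close>.
\<close>

lemma degree_weight_has_derivative:
  assumes "0 \<le> y"
  shows "(degree_weight d has_real_derivative
    (real d * degree_weight (d - 1) y - (2 * real d + 3) * degree_weight d y +
     (real d + 2) * degree_weight (Suc d) y)) (at y within S)"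
proof -
  have nz: "1 + y \<noteq> 0" using assms by auto
  show ?thesis
  proof (cases d)
    case 0
    show ?thesis
      unfolding 0 degree_weight_def using nz
      by (auto intro!: derivative_eq_intros simp: divide_simps) (simp add: algebra_simps power2_eq_square power3_eq_cube)
  next
    case (Suc e)
    show ?thesis
      unfolding Suc degree_weight_def using nz
      apply (auto intro!: derivative_eq_intros simp del: of_nat_Suc power_Suc)
      apply (simp add: divide_simps)
      apply (simp add: algebra_simps)
      done
  qed
qed

text \<open>
  The fundamental theorem of calculus applied to the previous formula: the weights vanish at
  infinity, and at \<open>0\<close> they vanish except for \<open>d = 0\<close>, which produces the inhomogeneous term.
\<close>

lemma degree_weight_integral_recurrence:
  "real d * (LBINT y:{0..}. degree_weight (d - 1) y)
   - (2 * real d + 3) * (LBINT y:{0..}. degree_weight d y)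
   + (real d + 2) * (LBINT y:{0..}. degree_weight (Suc d) y) = - of_bool (d = 0)"
proof -
  let ?g = "\<lambda>y. real d * degree_weight (d - 1) y - (2 * real d + 3) * degree_weight d y +
     (real d + 2) * degree_weight (Suc d) y"
  have int: "set_integrable lborel {0..} ?g"
    by (intro set_integral_add set_integral_diff set_integrable_mult_right set_integrable_degree_weight)
  have "((\<lambda>b. LBINT y:{0..b}. ?g y) \<longlongrightarrow> (LBINT y:{0..}. ?g y)) at_top"
    using int by (intro tendsto_set_lebesgue_integral_at_top) auto
  moreover have "(LBINT y:{0..b}. ?g y) = degree_weight d b - degree_weight d 0" if "0 \<le> b" for b
    unfolding set_lebesgue_integral_def
  proof (rule integral_FTC_atLeastAtMost[OF that])
    show "(degree_weight d has_vector_derivative ?g x) (at x within {0..b})" if "0 \<le> x" for x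
      using degree_weight_has_derivative[OF that]
      by (simp add: has_real_derivative_iff_has_vector_derivative)
    show "continuous_on {0..b} ?g"
      by (intro continuous_intros continuous_on_subset[OF continuous_on_degree_weight]) auto
  qed
  then have "\<forall>\<^sub>F b in at_top. degree_weight d b - degree_weight d 0 = (LBINT y:{0..b}. ?g y)"
    by (intro eventually_mono[OF eventually_ge_at_top[of 0]]) simp
  moreover have "(degree_weight d \<longlongrightarrow> 0) at_top"
  proof (rule tendsto_sandwich[of "\<lambda>_. 0" _ _ "\<lambda>y. exp (- y)"])
    show "\<forall>\<^sub>F y in at_top. 0 \<le> degree_weight d y"
      using eventually_ge_at_top[of 0] by eventually_elim (rule degree_weight_nonneg)
    show "\<forall>\<^sub>F y in at_top. degree_weight d y \<le> exp (- y)"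
      using eventually_ge_at_top[of 0] by eventually_elim (rule degree_weight_le_exp)
  qed (auto, real_asymp)
  then have "((\<lambda>b. degree_weight d b - degree_weight d 0) \<longlongrightarrow> 0 - degree_weight d 0) at_top"
    by (intro tendsto_intros)
  ultimately have "(LBINT y:{0..}. ?g y) = 0 - degree_weight d 0"
    by (intro tendsto_unique[OF trivial_limit_at_top_linorder _ Lim_transform_eventually])
  moreover have "degree_weight d 0 = of_bool (d = 0)"
    by (cases d) (auto simp: degree_weight_def)
  moreover have "(LBINT y:{0..}. ?g y) = real d * (LBINT y:{0..}. degree_weight (d - 1) y)
   - (2 * real d + 3) * (LBINT y:{0..}. degree_weight d y)
   + (real d + 2) * (LBINT y:{0..}. degree_weight (Suc d) y)"
    by (simp add: set_integral_add set_integral_diff set_integrable_mult_right set_integrable_degree_weight)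
  ultimately show ?thesis by simp
qed

lemma geometric_derivative_sums:
  fixes t :: real
  assumes "0 \<le> t" "t < 1"
  shows "(\<lambda>d. (real d + 1) * t ^ d) sums (1 / (1 - t)\<^sup>2)"
  using geometric_deriv_sums[of t] assms by (simp add: add.commute)

text \<open>
  The partial sums increase pointwise to \<open>exp (- y)\<close>, which is also the dominating function.
\<close>

lemma degree_density_sums_1: "degree_density sums 1"
proof -
  let ?h = "\<lambda>n y. \<Sum>d<n. (real d + 1) * (indicator {0..} y *\<^sub>R degree_weight d y)"
  have int: "integrable lborel (\<lambda>y. indicator {0..} y *\<^sub>R degree_weight d y)" for d
    using set_integrable_degree_weight[of d] by (simp add: set_integrable_def)
  have sums: "(\<lambda>d. (real d + 1) * (indicator {0..} y *\<^sub>R degree_weight d y)) sums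
      (indicator {0..} y *\<^sub>R exp (- y))" for y
  proof (cases "0 \<le> y")
    case True
    let ?t = "y / (1 + y)"
    have "(\<lambda>d. exp (- y) / (1 + y)\<^sup>2 * ((real d + 1) * ?t ^ d)) sums
        (exp (- y) / (1 + y)\<^sup>2 * (1 / (1 - ?t)\<^sup>2))"
      using True by (intro sums_mult geometric_derivative_sums) auto
    moreover have "1 - ?t = 1 / (1 + y)" using True by (simp add: field_simps)
    ultimately show ?thesis
      using True by (simp add: degree_weight_def power_divide power_add power2_eq_square mult_ac)
  qed auto
  have "(\<lambda>n. integral\<^sup>L lborel (?h n)) \<longlonglongrightarrow> (\<integral>y. indicator {0..} y *\<^sub>R exp (- y) \<partial>lborel)"
  proof (rule integral_dominated_convergence)
    show "integrable lborel (\<lambda>y. indicator {0..} y *\<^sub>R exp (- y) :: real)"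
      using has_bochner_integral_exp_minus by (rule integrable.intros)
    show "AE y in lborel. (\<lambda>n. ?h n y) \<longlonglongrightarrow> indicator {0..} y *\<^sub>R exp (- y)"
      using sums by (auto simp: sums_def)
    show "AE y in lborel. norm (?h n y) \<le> indicator {0..} y *\<^sub>R exp (- y)" for n
    proof (rule AE_I2)
      fix y :: real
      have nonneg: "0 \<le> (real d + 1) * (indicator {0..} y *\<^sub>R degree_weight d y)" for d
        by (auto split: split_indicator intro!: mult_nonneg_nonneg degree_weight_nonneg)
      then have "?h n y \<le> indicator {0..} y *\<^sub>R exp (- y)"
        using sum_le_suminf[OF sums_summable[OF sums[of y]], of "{..<n}"] sums_unique[OF sums[of y]]
        by simp
      then show "norm (?h n y) \<le> indicator {0..} y *\<^sub>R exp (- y)"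
        using nonneg by (simp add: sum_nonneg)
    qed
  qed (use int in \<open>auto intro!: borel_measurable_integrable\<close>)
  moreover have "(\<integral>y. indicator {0..} y *\<^sub>R exp (- y) \<partial>lborel) = (1::real)"
    using has_bochner_integral_exp_minus by (rule has_bochner_integral_integral_eq)
  moreover have "integral\<^sup>L lborel (?h n) = (\<Sum>d<n. degree_density d)" for n
    using int by (simp add: degree_density_def set_lebesgue_integral_def)
  ultimately show ?thesis by (simp add: sums_def)
qed

lemma degree_density_recurrence:
  "degree_density d = of_bool (d = 0) + (real d + 1) * (if d = 0 then 0 else degree_density (d - 1))
     - 2 * (real d + 1) * degree_density d + (real d + 1) * degree_density (Suc d)"
proof -
  have "(real d + 1) * (real d * (LBINT y:{0..}. degree_weight (d - 1) y)
     - (2 * real d + 3) * (LBINT y:{0..}. degree_weight d y)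
     + (real d + 2) * (LBINT y:{0..}. degree_weight (Suc d) y)) = (real d + 1) * - of_bool (d = 0)"
    by (subst degree_weight_integral_recurrence) simp
  then show ?thesis
    by (cases d) (auto simp: degree_density_def algebra_simps)
qed

text \<open>
  Scaled to start at \<open>1\<close>, a nonzero solution \<open>g\<close> has second differences
  \<open>g (d + 1) / (d + 2)\<close>, so as long as it is positive its increments do not decrease; the first
  increment is \<open>2\<close>, and linear growth follows by induction.
\<close>

lemma bounded_homogeneous_zero:
  fixes h :: "nat \<Rightarrow> real"
  assumes rec: "\<And>d. h d = (real d + 1) * (if d = 0 then 0 else h (d - 1))
     - 2 * (real d + 1) * h d + (real d + 1) * h (Suc d)"
    and bounded: "\<And>d. \<bar>h d\<bar> \<le> B"
  shows "h d = 0"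
proof -
  have "h 0 = 0"
  proof (rule ccontr)
    assume nz: "h 0 \<noteq> 0"
    define g where "g d = h d / h 0" for d
    have h: "h d = h 0 * g d" for d using nz by (simp add: g_def)
    have growth: "1 \<le> g d \<and> 2 \<le> g (Suc d) - g d" for d
    proof (induction d)
      case 0
      have "h 1 = 3 * h 0" using rec[of 0] by simp
      then show ?case using nz by (simp add: g_def)
    next
      case (Suc d)
      have "h 0 * g (Suc d) = h 0 * ((real d + 2) * (g d - 2 * g (Suc d) + g (Suc (Suc d))))"
        using rec[of "Suc d"] unfolding h[of "Suc d"] h[of "Suc (Suc d)"]
        by (simp add: h[of d] algebra_simps)
      then have "g (Suc d) = (real d + 2) * (g d - 2 * g (Suc d) + g (Suc (Suc d)))"
        using nz by simp
      moreover have "0 \<le> g (Suc d)" using Suc by auto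
      ultimately have "0 \<le> (real d + 2) * (g d - 2 * g (Suc d) + g (Suc (Suc d)))"
        by simp
      then have "0 \<le> g d - 2 * g (Suc d) + g (Suc (Suc d))"
        by (simp add: zero_le_mult_iff)
      then show ?case using Suc by auto
    qed
    have "real d \<le> g d" for d
    proof (induction d)
      case 0 then show ?case using growth[of 0] by auto
    next
      case (Suc d) then show ?case using growth[of d] by auto
    qed
    moreover obtain k where "B / \<bar>h 0\<bar> < real k" using reals_Archimedean2 by blast
    ultimately have "B / \<bar>h 0\<bar> < \<bar>g k\<bar>" by (smt (verit))
    then have "B < \<bar>h k\<bar>" using nz by (simp add: h[of k] abs_mult field_simps)
    then show False using bounded[of k] by simp
  qed
  moreover have "h (Suc d) = 0" if "h d = 0" "d > 0 \<Longrightarrow> h (d - 1) = 0" for d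
    using rec[of d] that by (auto split: if_splits)
  ultimately show ?thesis
    by (induction d rule: less_induct)
       (metis One_nat_def Suc_pred diff_less lessI less_imp_diff_less not_gr_zero zero_less_one)
qed

section \<open>The limiting proportions\<close>

text \<open>
  Convergent sequences converge in the mean, in a form fitted to \<open>n + 1\<close> vertices after \<open>n\<close>
  steps.
\<close>

lemma LIMSEQ_average_of_increments:
  fixes a :: "nat \<Rightarrow> real"
  assumes "(\<lambda>n. a (Suc n) - a n) \<longlonglongrightarrow> L"
  shows "(\<lambda>n. a n / (real n + 1)) \<longlonglongrightarrow> L"
proof -
  define b where "b n = a n - L * (real n + 1)" for n
  have lim: "(\<lambda>n. b n / (real n + 1)) \<longlonglongrightarrow> 0"
  proof (rule LIMSEQ_I)
    fix e :: real assume "0 < e"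
    then have e: "0 < e / 2" by simp
    obtain K where K: "\<And>n. K \<le> n \<Longrightarrow> \<bar>b (Suc n) - b n\<bar> < e / 2"
      using LIMSEQ_D[OF assms e] by (auto simp: b_def algebra_simps)
    have le: "\<bar>b n\<bar> \<le> \<bar>b K\<bar> + real (n - K) * (e / 2)" if "K \<le> n" for n
      using that
    proof (induction rule: dec_induct)
      case (step n)
      have "\<bar>b (Suc n)\<bar> \<le> \<bar>b n\<bar> + \<bar>b (Suc n) - b n\<bar>" by simp
      also have "\<dots> \<le> \<bar>b K\<bar> + real (n - K) * (e / 2) + e / 2"
        using step K[of n] by (intro add_mono) auto
      finally have "\<bar>b (Suc n)\<bar> \<le> \<bar>b K\<bar> + (real (n - K) * (e / 2) + e / 2)" by simp
      moreover have "real (Suc n - K) = real (n - K) + 1" using step by simp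
      ultimately show ?case by (simp only: distrib_right mult_1)
    qed simp
    obtain m where m: "2 * \<bar>b K\<bar> / e < real m" using reals_Archimedean2 by blast
    have "norm (b n / (real n + 1) - 0) < e" if n: "max K m \<le> n" for n
    proof -
      have "\<bar>b K\<bar> < e / 2 * real m" using m \<open>0 < e\<close> by (simp add: field_simps)
      also have "\<dots> \<le> e / 2 * real n" using n e by (intro mult_left_mono) auto
      finally have "\<bar>b K\<bar> < e / 2 * real n" .
      moreover have "real (n - K) * (e / 2) \<le> real n * (e / 2)"
        using e by (intro mult_right_mono) auto
      moreover have "\<bar>b n\<bar> \<le> \<bar>b K\<bar> + real (n - K) * (e / 2)" using n by (intro le) simp
      ultimately have "\<bar>b n\<bar> < e / 2 * real n + real n * (e / 2)" by linarith
      also have "\<dots> = e * real n" by simp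
      also have "\<dots> \<le> e * (real n + 1)" using \<open>0 < e\<close> by simp
      finally show ?thesis by (simp add: field_simps)
    qed
    then show "\<exists>no. \<forall>n\<ge>no. norm (b n / (real n + 1) - 0) < e" by blast
  qed
  have "(\<lambda>n. b n / (real n + 1) + L) \<longlonglongrightarrow> 0 + L"
    by (intro tendsto_intros lim)
  moreover have "b n / (real n + 1) + L = a n / (real n + 1)" for n
    by (simp add: b_def field_simps add_nonneg_eq_0_iff)
  ultimately show ?thesis by simp
qed

context duplication_deletion_process
begin

definition mean_count :: "nat \<Rightarrow> nat \<Rightarrow> real" where
  "mean_count n d = expectation (\<lambda>\<omega>. degree_sum (\<lambda>k. of_bool (k = d)) n (graph n \<omega>))"

lemma degree_count_eq_degree_sum:
  "real (degree_count U V n d \<omega>) = degree_sum (\<lambda>k. of_bool (k = d)) n (graph n \<omega>)"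
proof -
  have "{w \<in> {..n}. vertex_degree (graph n \<omega>) w = d} = {..n} \<inter> {w. vertex_degree (graph n \<omega>) w = d}"
    by blast
  then show ?thesis by (simp add: degree_count_def degree_sum_def)
qed

lemma degree_proportion_bounds:
  "0 \<le> real (degree_count U V n d \<omega>) / (real n + 1)"
  "real (degree_count U V n d \<omega>) / (real n + 1) \<le> 1"
proof -
  have "degree_count U V n d \<omega> \<le> card {..n}"
    unfolding degree_count_def by (intro card_mono) auto
  then show "real (degree_count U V n d \<omega>) / (real n + 1) \<le> 1"
    by simp
qed simp

text \<open>
  Every mean count is arranged as a mean proportion times a coefficient that converges for fixed \<open>d\<close>,
  so that limits can be taken factor by factor.
\<close>

lemma mean_count_step:
  "mean_count (Suc n) d - mean_count n d =
     (if d = 0 then 0 else mean_count n (d - 1) / (real n + 1)) *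
       (((real n + 1) + (real n + 1 - real d) * real d) / (real n + 1))
   + mean_count n d / (real n + 1) *
       ((real d * (real d + 1) + (real n - real d)\<^sup>2) / (real n + 1) - (real n + 1))
   + mean_count n (Suc d) / (real n + 1) * ((real d + 1) * (real n - real d - 1) / (real n + 1))
   + of_bool (d = 1) * ((3 * real n + 1) / (real n + 1)\<^sup>2)
   + of_bool (d = 0) * ((real n + 1) * real n - 2 * real n) / (real n + 1)\<^sup>2"
proof -
  let ?X = "\<lambda>d \<omega>. degree_sum (\<lambda>k. of_bool (k = d)) n (graph n \<omega>)"
  let ?S = "\<lambda>\<omega>. degree_sum real n (graph n \<omega>)"
  let ?A = "(real n + 1) + (real n + 1 - real d) * real d"
  let ?B = "real d * (real d + 1) + (real n - real d)\<^sup>2"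
  let ?C = "(real d + 1) * (real n - real d - 1)"
  let ?rhs = "\<lambda>\<omega>. (if d = 0 then 0 else ?X (d - 1) \<omega>) * ?A + ?X d \<omega> * ?B + ?X (Suc d) \<omega> * ?C
     + of_bool (d = 1) * (?S \<omega> + (real n + 1)) + of_bool (d = 0) * ((real n + 1) * real n - ?S \<omega>)"
  note int = integrable_graph[of "degree_sum \<phi> n" n for \<phi>]
  have p: "integrable M (\<lambda>\<omega>. if d = 0 then 0 else ?X (d - 1) \<omega>)"
    "expectation (\<lambda>\<omega>. if d = 0 then 0 else ?X (d - 1) \<omega>) = (if d = 0 then 0 else mean_count n (d - 1))"
    using int by (cases d; simp add: mean_count_def)+
  have "expectation (\<lambda>\<omega>. degree_sum (step_total (\<lambda>k. of_bool (k = d)) n) n (graph n \<omega>)) = expectation ?rhs"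
  proof (rule integral_cong_AE)
    show "AE \<omega> in M. degree_sum (step_total (\<lambda>k. of_bool (k = d)) n) n (graph n \<omega>) = ?rhs \<omega>"
      using AE_simple_graph by eventually_elim (intro degree_sum_step_total_indicator, blast)
  qed (use int p in \<open>auto intro!: borel_measurable_integrable Bochner_Integration.integrable_add Bochner_Integration.integrable_diff borel_measurable_graph\<close>)
  also have "\<dots> = (if d = 0 then 0 else mean_count n (d - 1)) * ?A + mean_count n d * ?B
     + mean_count n (Suc d) * ?C + of_bool (d = 1) * (2 * real n + (real n + 1))
     + of_bool (d = 0) * ((real n + 1) * real n - 2 * real n)"
    using int p by (simp add: prob_space expectation_total_degree mean_count_def)
  finally have "mean_count (Suc n) d = ((if d = 0 then 0 else mean_count n (d - 1)) * ?A + mean_count n d * ?B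
     + mean_count n (Suc d) * ?C + of_bool (d = 1) * (2 * real n + (real n + 1))
     + of_bool (d = 0) * ((real n + 1) * real n - 2 * real n)) / (real n + 1)\<^sup>2"
    unfolding mean_count_def[of "Suc n" d] expectation_degree_sum_step by (rule arg_cong)
  moreover have "(p * A + m * B + q * C + s * S + t * T) / N\<^sup>2 - m =
      p / N * (A / N) + m / N * (B / N - N) + q / N * (C / N) + s * (S / N\<^sup>2) + t * T / N\<^sup>2"
    if "N \<noteq> 0" for p m q s t A B C S T N :: real
    using that by (simp add: field_simps power2_eq_square)
  moreover have "real n + 1 \<noteq> 0" by linarith
  moreover have "(if d = 0 then 0 else mean_count n (d - 1) / (real n + 1)) =
      (if d = 0 then 0 else mean_count n (d - 1)) / (real n + 1)"
    by simp
  moreover have "2 * real n + (real n + 1) = 3 * real n + 1" by simp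
  ultimately show ?thesis by presburger
qed

context
  fixes c :: "nat \<Rightarrow> real"
  assumes limit: "\<And>d. AE \<omega> in M. (\<lambda>n. real (degree_count U V n d \<omega>) / (real n + 1)) \<longlonglongrightarrow> c d"
begin

lemma mean_proportion_tendsto: "(\<lambda>n. mean_count n d / (real n + 1)) \<longlonglongrightarrow> c d"
proof -
  have "(\<lambda>n. expectation (\<lambda>\<omega>. real (degree_count U V n d \<omega>) / (real n + 1))) \<longlonglongrightarrow> expectation (\<lambda>\<omega>. c d)"
  proof (rule integral_dominated_convergence)
    show "(\<lambda>\<omega>. real (degree_count U V n d \<omega>) / (real n + 1)) \<in> borel_measurable M" for n
      unfolding degree_count_eq_degree_sum by (intro borel_measurable_divide borel_measurable_graph)
    show "AE \<omega> in M. norm (real (degree_count U V n d \<omega>) / (real n + 1)) \<le> 1" for n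
      using degree_proportion_bounds[of n d] by simp
  qed (use limit in auto)
  then show ?thesis
    by (simp add: degree_count_eq_degree_sum mean_count_def prob_space)
qed

lemma limit_bounds: "0 \<le> c d" "c d \<le> 1"
proof -
  have "AE \<omega> in M. 0 \<le> c d \<and> c d \<le> 1"
    using limit[of d]
  proof eventually_elim
    case (elim \<omega>)
    then show ?case
      using degree_proportion_bounds[of _ d \<omega>] by (blast intro: LIMSEQ_le_const LIMSEQ_le_const2)
  qed
  then show "0 \<le> c d" "c d \<le> 1" by simp_all
qed

text \<open>
  The proportions converge to \<open>c d\<close>, but by the averaging lemma also to the limit of the
  increments of the mean counts; the two limits agree.
\<close>

lemma limit_recurrence:
  "c d = of_bool (d = 0) + (real d + 1) * (if d = 0 then 0 else c (d - 1))
     - 2 * (real d + 1) * c d + (real d + 1) * c (Suc d)"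
proof -
  let ?R = "(if d = 0 then 0 else c (d - 1)) * (1 + real d) + c d * (- 2 * (real d + 1)) + c (Suc d) * (real d + 1)
     + of_bool (d = 1) * 0 + of_bool (d = 0) * 1"
  have "(\<lambda>n. mean_count (Suc n) d - mean_count n d) \<longlonglongrightarrow> ?R"
    unfolding mean_count_step times_divide_eq_right[symmetric, of "of_bool _"]
  proof (intro tendsto_add tendsto_mult mean_proportion_tendsto tendsto_const)
    show "(\<lambda>n. if d = 0 then 0 else mean_count n (d - 1) / (real n + 1)) \<longlonglongrightarrow> (if d = 0 then 0 else c (d - 1))"
      using mean_proportion_tendsto by simp
  qed real_asymp+
  then have "(\<lambda>n. mean_count n d / (real n + 1)) \<longlonglongrightarrow> ?R"
    by (rule LIMSEQ_average_of_increments)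
  then have "c d = ?R"
    using mean_proportion_tendsto LIMSEQ_unique by blast
  then show ?thesis by (simp add: algebra_simps)
qed

text \<open>
  The difference of the two sequences solves the homogeneous recurrence and is bounded by \<open>1\<close>:
  the \<open>c d\<close> are limits of proportions, and the densities are nonnegative terms of a series with
  sum \<open>1\<close>.
\<close>

lemma limit_eq_degree_density: "c d = degree_density d"
proof -
  have density_bounds: "0 \<le> degree_density d" "degree_density d \<le> 1" for d
  proof -
    show nonneg: "0 \<le> degree_density d" for d
      unfolding degree_density_def set_lebesgue_integral_def
      by (intro mult_nonneg_nonneg integral_nonneg_AE)
         (auto split: split_indicator simp: degree_weight_nonneg)
    show "degree_density d \<le> 1"
      using sum_le_suminf[OF sums_summable[OF degree_density_sums_1], of "{d}"] nonneg
        sums_unique[OF degree_density_sums_1] by simp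
  qed
  have "c d - degree_density d = 0"
  proof (rule bounded_homogeneous_zero[where h = "\<lambda>d. c d - degree_density d" and B = 1])
    show "\<bar>c d - degree_density d\<bar> \<le> 1" for d
      using limit_bounds[of d] density_bounds[of d] by auto
    show "c d - degree_density d =
        (real d + 1) * (if d = 0 then 0 else c (d - 1) - degree_density (d - 1))
        - 2 * (real d + 1) * (c d - degree_density d) + (real d + 1) * (c (Suc d) - degree_density (Suc d))" for d
      by (subst (1) limit_recurrence, subst (1) degree_density_recurrence) (simp add: algebra_simps)
  qed
  then show ?thesis by simp
qed

end

end

theorem theorem2:
  fixes M :: "'a measure" and U V :: "nat \<Rightarrow> 'a \<Rightarrow> nat" and c :: "nat \<Rightarrow> real"
  assumes process: "duplication_deletion_process M U V"
    and limit: "\<And>d. AE \<omega> in M.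
      (\<lambda>n. real (degree_count U V n d \<omega>) / (real n + 1)) \<longlonglongrightarrow> c d"
  shows "(\<forall>d. set_integrable lborel {0..} (\<lambda>y::real. y ^ d * exp (- y) / (1 + y) ^ (d + 2)) \<and>
            c d = (real d + 1) * (LBINT y:{0..}. y ^ d * exp (- y) / (1 + y) ^ (d + 2)))
         \<and> c sums 1"
proof -
  interpret duplication_deletion_process M U V by (rule process)
  have c: "c = degree_density"
    using limit_eq_degree_density[OF limit] by (rule ext)
  show ?thesis
    using set_integrable_degree_weight degree_density_sums_1
    unfolding c degree_density_def degree_weight_def[abs_def] by simp
qed

end
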